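(* Let $G$ be a finite group acting on a Lie-Yamaguti algebra $(L,[\cdot,\cdot],\{\cdot,\cdot,\cdot\})$ over $\mathbb{K}$, and let $(f_t,h_t)$, $f_t=\sum_{i\ge0}f_it^i$, $h_t=\sum_{i\ge0}h_it^i$, be an equivariant 1-parameter formal deformation of $L$. Then $(f_1,h_1)\in Z_G^2(L,L)\times Z_G^3(L,L)$.
   Context: $\mathbb{K}$ is an algebraically closed field of characteristic different from 2 and 3. **Lie-Yamaguti algebra.** A $\mathbb{K}$-vector space $L$ with a bilinear operation $[\cdot,\cdot]$ and a trilinear operation $\{\cdot,\cdot,\cdot\}$ such that for all $x,y,z,u,v,w\in L$ (where $\circlearrowleft_{(x,y,z)}$ denotes the sum over cyclic permutations of $x,y,z$): (LY1) $[x,y]=-[y,x]$; (LY2) $\{x,y,z\}=-\{y,x,z\}$; (LY3) $\circlearrowleft_{(x,y,z)}([[x,y],z]+\{x,y,z\})=0$; (LY4) $\circlearrowleft_{(x,y,z)}\{[x,y],z,u\}=0$; (LY5) $\{x,y,[u,v]\}=[\{x,y,u\},v]+[u,\{x,y,v\}]$; (LY6) $\{x,y,\{u,v,w\}\}=\{\{x,y,u\},v,w\}+\{u,\{x,y,v\},w\}+\{u,v,\{x,y,w\}\}$. The same definition is used over $\mathbb{K}[[t]]$ (with $\mathbb{K}[[t]]$-multilinear operations). **Group action.** A finite group $G$ acts on $L$ if there is a map $G\times L\to L$, $(\sigma,a)\mapsto\sigma a$, such that each $a\mapsto\sigma a$ is linear, $ea=a$, $\sigma(\tau a)=(\sigma\tau)a$,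 $\sigma[a,b]=[\sigma a,\sigma b]$ and $\sigma\{a,b,c\}=\{\sigma a,\sigma b,\sigma c\}$ for all $\sigma,\tau\in G$, $a,b,c\in L$. **Equivariant formal deformations.** $L[[t]]$ is the $\mathbb{K}[[t]]$-module of formal power series with coefficients in $L$. An equivariant 1-parameter formal deformation of $L$ is a pair $(f_t,h_t)$, $f_t=\sum_{i\ge0}f_it^i$, $h_t=\sum_{i\ge0}h_it^i$, with $f_0=[\cdot,\cdot]$, $h_0=\{\cdot,\cdot,\cdot\}$, each $f_i:L\times L\to L$ $\mathbb{K}$-bilinear and each $h_i:L\times L\times L\to L$ $\mathbb{K}$-trilinear (extended $\mathbb{K}[[t]]$-multilinearly to $L[[t]]$), such that $(L[[t]],f_t,h_t)$ is a Lie-Yamaguti algebra over $\mathbb{K}[[t]]$ and $f_i(\sigma a,\sigma b)=\sigma f_i(a,b)$, $h_i(\sigma a,\sigma b,\sigma c)=\sigma h_i(a,b,c)$ for all $a,b,c\in L$, $\sigma\in G$, $i\ge1$. **Equivariant cocycles (adjoint coefficients).** $C^n(L,L)$ is the space of $n$-linear maps $f:L^n\to L$ with $f(x_1,\dots,x_n)=0$ whenever $x_{2i-1}=x_{2i}$ for some $i$ with $2i\le n$, and $C_G^n(L,L)=\{f\in C^n(L,L): f(\sigma x_1,\dots,\sigma x_n)=\sigma f(x_1,\dots,x_n)\ \forall\sigma\in G, x_i\in L\}$. For $(f,h)\in C^2(L,L)\times C^3(L,L)$, $\delta(f,h)=(\delta_If,\delta_{II}h)$, where $(\delta_If)(x_1,\dots,x_4)=[x_3,h(x_1,x_2,x_4)]-[x_4,h(x_1,x_2,x_3)]-h(x_1,x_2,[x_3,x_4])-\{x_1,x_2,f(x_3,x_4)\}+f(\{x_1,x_2,x_3\},x_4)+f(x_3,\{x_1,x_2,x_4\})$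 (this depends on both $f$ and $h$), $(\delta_{II}h)(x_1,\dots,x_5)=\{h(x_1,x_2,x_3),x_4,x_5\}-\{h(x_1,x_2,x_4),x_3,x_5\}-\{x_1,x_2,h(x_3,x_4,x_5)\}+\{x_3,x_4,h(x_1,x_2,x_5)\}+h(\{x_1,x_2,x_3\},x_4,x_5)+h(x_3,\{x_1,x_2,x_4\},x_5)+h(x_3,x_4,\{x_1,x_2,x_5\})-h(x_1,x_2,\{x_3,x_4,x_5\})$. $Z_G^2(L,L)\times Z_G^3(L,L)$ denotes the subspace of all $(f,h)\in C_G^2(L,L)\times C_G^3(L,L)$ with $\delta(f,h)=(0,0)$ (the product symbol is notation for this single subspace). *)

theory Defs
  imports
    "HOL-Algebra.Group_Action"
    "HOL-Computational_Algebra.Computational_Algebra"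
begin

definition bilinear_op ::
  "('r::comm_ring_1 \<Rightarrow> 'l::ab_group_add \<Rightarrow> 'l) \<Rightarrow> ('l \<Rightarrow> 'l \<Rightarrow> 'l) \<Rightarrow> bool" where
  "bilinear_op scale f \<longleftrightarrow>
     (\<forall>y. module_hom scale scale (\<lambda>x. f x y)) \<and>
     (\<forall>x. module_hom scale scale (\<lambda>y. f x y))"

definition trilinear_op ::
  "('r::comm_ring_1 \<Rightarrow> 'l::ab_group_add \<Rightarrow> 'l) \<Rightarrow> ('l \<Rightarrow> 'l \<Rightarrow> 'l \<Rightarrow> 'l) \<Rightarrow> bool" where
  "trilinear_op scale h \<longleftrightarrow>
     (\<forall>y z. module_hom scale scale (\<lambda>x. h x y z)) \<and>
     (\<forall>x z. module_hom scale scale (\<lambda>y. h x y z)) \<and>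
     (\<forall>x y. module_hom scale scale (\<lambda>z. h x y z))"

text \<open>
  The scalars form an arbitrary commutative ring, so that the same locale covers both
  vector spaces over a field and modules over its ring of formal power series.
\<close>

locale lie_yamaguti = module scale
  for scale :: "'r::comm_ring_1 \<Rightarrow> 'l::ab_group_add \<Rightarrow> 'l" +
  fixes br :: "'l \<Rightarrow> 'l \<Rightarrow> 'l"
    and tr :: "'l \<Rightarrow> 'l \<Rightarrow> 'l \<Rightarrow> 'l"
  assumes bilinear_br: "bilinear_op scale br"
    and trilinear_tr: "trilinear_op scale tr"
    and LY1: "br x y = - br y x"
    and LY2: "tr x y z = - tr y x z"
    and LY3: "(br (br x y) z + tr x y z) + (br (br y z) x + tr y z x)
                + (br (br z x) y + tr z x y) = 0"
    and LY4: "tr (br x y) z u + tr (br y z) x u + tr (br z x) y u = 0"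
    and LY5: "tr x y (br u v) = br (tr x y u) v + br u (tr x y v)"
    and LY6: "tr x y (tr u v w) = tr (tr x y u) v w + tr u (tr x y v) w + tr u v (tr x y w)"

locale lie_yamaguti_action =
  lie_yamaguti scale br tr + group_action G UNIV \<phi>
  for scale :: "'k::field \<Rightarrow> 'l::ab_group_add \<Rightarrow> 'l"
    and br :: "'l \<Rightarrow> 'l \<Rightarrow> 'l"
    and tr :: "'l \<Rightarrow> 'l \<Rightarrow> 'l \<Rightarrow> 'l"
    and G :: "('g, 'm) monoid_scheme"
    and \<phi> :: "'g \<Rightarrow> 'l \<Rightarrow> 'l" +
  assumes action_linear: "\<sigma> \<in> carrier G \<Longrightarrow> Vector_Spaces.linear scale scale (\<phi> \<sigma>)"
    and action_br: "\<sigma> \<in> carrier G \<Longrightarrow> \<phi> \<sigma> (br a b) = br (\<phi> \<sigma> a) (\<phi> \<sigma> b)"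
    and action_tr: "\<sigma> \<in> carrier G \<Longrightarrow> \<phi> \<sigma> (tr a b c) = tr (\<phi> \<sigma> a) (\<phi> \<sigma> b) (\<phi> \<sigma> c)"

definition fps_scale ::
  "('k::comm_ring_1 \<Rightarrow> 'l::ab_group_add \<Rightarrow> 'l) \<Rightarrow> 'k fps \<Rightarrow> 'l fps \<Rightarrow> 'l fps" where
  "fps_scale scale c a = Abs_fps (\<lambda>n. \<Sum>i\<le>n. scale (fps_nth c i) (fps_nth a (n - i)))"

lemma module_fps_scale:
  assumes "module scale"
  shows "module (fps_scale scale)"
proof -
  interpret module scale by fact
  show ?thesis
  proof
    fix a b :: "'a fps" and x y :: "'b fps"
    show "fps_scale scale a (x + y) = fps_scale scale a x + fps_scale scale a y"
      by (simp add: fps_scale_def fps_eq_iff scale_right_distrib sum.distrib)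
    show "fps_scale scale (a + b) x = fps_scale scale a x + fps_scale scale b x"
      by (simp add: fps_scale_def fps_eq_iff scale_left_distrib sum.distrib)
    show "fps_scale scale 1 x = x"
    proof (rule fps_ext)
      fix n
      have "fps_nth (fps_scale scale 1 x) n
          = (\<Sum>i\<le>n. if i = 0 then fps_nth x n else 0)"
        unfolding fps_scale_def fps_nth_Abs_fps by (intro sum.cong) auto
      then show "fps_nth (fps_scale scale 1 x) n = fps_nth x n" by simp
    qed
    show "fps_scale scale a (fps_scale scale b x) = fps_scale scale (a * b) x"
    proof (rule fps_ext)
      fix n
      show "fps_nth (fps_scale scale a (fps_scale scale b x)) n
          = fps_nth (fps_scale scale (a * b) x) n"
        using fps_mult_assoc_lemma[where k = n and
            f = "\<lambda>i j k. scale (fps_nth a i * fps_nth b j) (fps_nth x k)"]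
        by (simp add: fps_scale_def fps_mult_nth scale_sum_left scale_sum_right
            atLeast0AtMost)
    qed
  qed
qed

text \<open>
  For a family \<open>f\<close> of bilinear maps, the extension of \<open>\<Sum>i. f i t\<^sup>i\<close> to power series:
  the coefficient at \<open>t\<^sup>n\<close> is the sum of \<open>f i (a\<^sub>j) (b\<^sub>k)\<close> over all \<open>i + j + k = n\<close>;
  similarly for trilinear maps.
\<close>

definition fps_ext2 ::
  "(nat \<Rightarrow> 'l \<Rightarrow> 'l \<Rightarrow> 'l::ab_group_add) \<Rightarrow> 'l fps \<Rightarrow> 'l fps \<Rightarrow> 'l fps" where
  "fps_ext2 f a b = Abs_fps (\<lambda>n. \<Sum>i\<le>n. \<Sum>j\<le>n - i.
     f i (fps_nth a j) (fps_nth b (n - i - j)))"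

definition fps_ext3 ::
  "(nat \<Rightarrow> 'l \<Rightarrow> 'l \<Rightarrow> 'l \<Rightarrow> 'l::ab_group_add) \<Rightarrow> 'l fps \<Rightarrow> 'l fps \<Rightarrow> 'l fps \<Rightarrow> 'l fps" where
  "fps_ext3 h a b c = Abs_fps (\<lambda>n. \<Sum>i\<le>n. \<Sum>j\<le>n - i. \<Sum>k\<le>n - i - j.
     h i (fps_nth a j) (fps_nth b k) (fps_nth c (n - i - j - k)))"

definition equivariant2 ::
  "('g, 'm) monoid_scheme \<Rightarrow> ('g \<Rightarrow> 'l \<Rightarrow> 'l) \<Rightarrow> ('l \<Rightarrow> 'l \<Rightarrow> 'l) \<Rightarrow> bool" where
  "equivariant2 G \<phi> f \<longleftrightarrow>
     (\<forall>\<sigma>\<in>carrier G. \<forall>a b. f (\<phi> \<sigma> a) (\<phi> \<sigma> b) = \<phi> \<sigma> (f a b))"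

definition equivariant3 ::
  "('g, 'm) monoid_scheme \<Rightarrow> ('g \<Rightarrow> 'l \<Rightarrow> 'l) \<Rightarrow> ('l \<Rightarrow> 'l \<Rightarrow> 'l \<Rightarrow> 'l) \<Rightarrow> bool" where
  "equivariant3 G \<phi> h \<longleftrightarrow>
     (\<forall>\<sigma>\<in>carrier G. \<forall>a b c. h (\<phi> \<sigma> a) (\<phi> \<sigma> b) (\<phi> \<sigma> c) = \<phi> \<sigma> (h a b c))"

definition equivariant_formal_deformation ::
  "('k::field \<Rightarrow> 'l::ab_group_add \<Rightarrow> 'l) \<Rightarrow> ('l \<Rightarrow> 'l \<Rightarrow> 'l) \<Rightarrow> ('l \<Rightarrow> 'l \<Rightarrow> 'l \<Rightarrow> 'l) \<Rightarrow>
   ('g, 'm) monoid_scheme \<Rightarrow> ('g \<Rightarrow> 'l \<Rightarrow> 'l) \<Rightarrow>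
   (nat \<Rightarrow> 'l \<Rightarrow> 'l \<Rightarrow> 'l) \<Rightarrow> (nat \<Rightarrow> 'l \<Rightarrow> 'l \<Rightarrow> 'l \<Rightarrow> 'l) \<Rightarrow> bool" where
  "equivariant_formal_deformation scale br tr G \<phi> f h \<longleftrightarrow>
     f 0 = br \<and> h 0 = tr \<and>
     (\<forall>i. bilinear_op scale (f i)) \<and> (\<forall>i. trilinear_op scale (h i)) \<and>
     lie_yamaguti (fps_scale scale) (fps_ext2 f) (fps_ext3 h) \<and>
     (\<forall>i\<ge>1. equivariant2 G \<phi> (f i) \<and> equivariant3 G \<phi> (h i))"

text \<open>
  The cochain condition, vanishing whenever \<open>x\<^bsub>2i-1\<^esub> = x\<^bsub>2i\<^esub>\<close> with \<open>2i \<le> n\<close>, only involves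
  the first two arguments for \<open>n = 2\<close> and for \<open>n = 3\<close>. Cochains are curried.
\<close>

definition C2 :: "('k::field \<Rightarrow> 'l::ab_group_add \<Rightarrow> 'l) \<Rightarrow> ('l \<Rightarrow> 'l \<Rightarrow> 'l) set" where
  "C2 scale = {f. bilinear_op scale f \<and> (\<forall>x. f x x = 0)}"

definition C3 :: "('k::field \<Rightarrow> 'l::ab_group_add \<Rightarrow> 'l) \<Rightarrow> ('l \<Rightarrow> 'l \<Rightarrow> 'l \<Rightarrow> 'l) set" where
  "C3 scale = {h. trilinear_op scale h \<and> (\<forall>x z. h x x z = 0)}"

definition C2_G ::
  "('k::field \<Rightarrow> 'l::ab_group_add \<Rightarrow> 'l) \<Rightarrow> ('g, 'm) monoid_scheme \<Rightarrow> ('g \<Rightarrow> 'l \<Rightarrow> 'l) \<Rightarrow>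
   ('l \<Rightarrow> 'l \<Rightarrow> 'l) set" where
  "C2_G scale G \<phi> = {f \<in> C2 scale. equivariant2 G \<phi> f}"

definition C3_G ::
  "('k::field \<Rightarrow> 'l::ab_group_add \<Rightarrow> 'l) \<Rightarrow> ('g, 'm) monoid_scheme \<Rightarrow> ('g \<Rightarrow> 'l \<Rightarrow> 'l) \<Rightarrow>
   ('l \<Rightarrow> 'l \<Rightarrow> 'l \<Rightarrow> 'l) set" where
  "C3_G scale G \<phi> = {h \<in> C3 scale. equivariant3 G \<phi> h}"

definition delta_I ::
  "('l \<Rightarrow> 'l \<Rightarrow> 'l) \<Rightarrow> ('l \<Rightarrow> 'l \<Rightarrow> 'l \<Rightarrow> 'l) \<Rightarrow>
   ('l \<Rightarrow> 'l \<Rightarrow> 'l) \<Rightarrow> ('l \<Rightarrow> 'l \<Rightarrow> 'l \<Rightarrow> 'l) \<Rightarrow>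
   'l \<Rightarrow> 'l \<Rightarrow> 'l \<Rightarrow> 'l \<Rightarrow> 'l::ab_group_add" where
  "delta_I br tr f h x1 x2 x3 x4 =
     br x3 (h x1 x2 x4) - br x4 (h x1 x2 x3) - h x1 x2 (br x3 x4)
     - tr x1 x2 (f x3 x4) + f (tr x1 x2 x3) x4 + f x3 (tr x1 x2 x4)"

definition delta_II ::
  "('l \<Rightarrow> 'l \<Rightarrow> 'l \<Rightarrow> 'l) \<Rightarrow> ('l \<Rightarrow> 'l \<Rightarrow> 'l \<Rightarrow> 'l) \<Rightarrow>
   'l \<Rightarrow> 'l \<Rightarrow> 'l \<Rightarrow> 'l \<Rightarrow> 'l \<Rightarrow> 'l::ab_group_add" where
  "delta_II tr h x1 x2 x3 x4 x5 =
     tr (h x1 x2 x3) x4 x5 - tr (h x1 x2 x4) x3 x5 - tr x1 x2 (h x3 x4 x5)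
     + tr x3 x4 (h x1 x2 x5) + h (tr x1 x2 x3) x4 x5 + h x3 (tr x1 x2 x4) x5
     + h x3 x4 (tr x1 x2 x5) - h x1 x2 (tr x3 x4 x5)"

definition delta ::
  "('l \<Rightarrow> 'l \<Rightarrow> 'l) \<Rightarrow> ('l \<Rightarrow> 'l \<Rightarrow> 'l \<Rightarrow> 'l) \<Rightarrow>
   ('l \<Rightarrow> 'l \<Rightarrow> 'l) \<times> ('l \<Rightarrow> 'l \<Rightarrow> 'l \<Rightarrow> 'l) \<Rightarrow>
   ('l \<Rightarrow> 'l \<Rightarrow> 'l \<Rightarrow> 'l \<Rightarrow> 'l) \<times> ('l \<Rightarrow> 'l \<Rightarrow> 'l \<Rightarrow> 'l \<Rightarrow> 'l \<Rightarrow> 'l::ab_group_add)" where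
  "delta br tr = (\<lambda>(f, h). (delta_I br tr f h, delta_II tr h))"

text \<open>
  The subspace written \<open>Z\<^sub>G\<^sup>2(L,L) \<times> Z\<^sub>G\<^sup>3(L,L)\<close>. It is not a product of two spaces, as the
  cocycle condition couples \<open>f\<close> and \<open>h\<close>.
\<close>

definition Z23_G ::
  "('k::field \<Rightarrow> 'l::ab_group_add \<Rightarrow> 'l) \<Rightarrow> ('l \<Rightarrow> 'l \<Rightarrow> 'l) \<Rightarrow> ('l \<Rightarrow> 'l \<Rightarrow> 'l \<Rightarrow> 'l) \<Rightarrow>
   ('g, 'm) monoid_scheme \<Rightarrow> ('g \<Rightarrow> 'l \<Rightarrow> 'l) \<Rightarrow>
   (('l \<Rightarrow> 'l \<Rightarrow> 'l) \<times> ('l \<Rightarrow> 'l \<Rightarrow> 'l \<Rightarrow> 'l)) set" where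
  "Z23_G scale br tr G \<phi> =
     {(f, h). (f, h) \<in> C2_G scale G \<phi> \<times> C3_G scale G \<phi> \<and>
        delta br tr (f, h) = ((\<lambda>_ _ _ _. 0), (\<lambda>_ _ _ _ _. 0))}"

end

theory Submission
  imports Defs
begin

text \<open>
  Evaluate the deformed identities on constant power series and compare coefficients at
  \<open>t\<close>: LY1 and LY2 give skew-symmetry, hence the alternating condition as \<open>2\<close> is
  invertible, while LY5 and LY6 give the two components of the cocycle condition.
\<close>

lemma bilinear_op_zero [simp]:
  assumes "bilinear_op scale f"
  shows "f 0 y = 0" "f x 0 = 0"
  using assms by (auto simp: bilinear_op_def dest: module_hom.zero)

lemma trilinear_op_zero [simp]:
  assumes "trilinear_op scale h"
  shows "h 0 y z = 0" "h x 0 z = 0" "h x y 0 = 0"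
proof -
  show "h 0 y z = 0"
    using assms module_hom.zero[of scale scale "\<lambda>x. h x y z"] by (simp add: trilinear_op_def)
  show "h x 0 z = 0"
    using assms module_hom.zero[of scale scale "\<lambda>y. h x y z"] by (simp add: trilinear_op_def)
  show "h x y 0 = 0"
    using assms module_hom.zero[of scale scale "\<lambda>z. h x y z"] by (simp add: trilinear_op_def)
qed

lemma fps_ext2_nth_0: "fps_nth (fps_ext2 f a b) 0 = f 0 (fps_nth a 0) (fps_nth b 0)"
  by (simp add: fps_ext2_def)

text \<open>The three terms are the ways to write 1 as a sum of three indices. The left side has
  \<open>Suc 0\<close>, the form into which the simplifier turns the index \<open>1\<close>, so the
  equation works as a rewrite rule.\<close>

lemma fps_ext2_nth_1:
  "fps_nth (fps_ext2 f a b) (Suc 0) =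
     f 0 (fps_nth a 0) (fps_nth b 1) + f 0 (fps_nth a 1) (fps_nth b 0)
     + f 1 (fps_nth a 0) (fps_nth b 0)"
  by (simp add: fps_ext2_def)

lemma fps_ext3_nth_0:
  "fps_nth (fps_ext3 h a b c) 0 = h 0 (fps_nth a 0) (fps_nth b 0) (fps_nth c 0)"
  by (simp add: fps_ext3_def)

lemma fps_ext3_nth_1:
  "fps_nth (fps_ext3 h a b c) (Suc 0) =
     h 0 (fps_nth a 0) (fps_nth b 0) (fps_nth c 1) + h 0 (fps_nth a 0) (fps_nth b 1) (fps_nth c 0)
     + h 0 (fps_nth a 1) (fps_nth b 0) (fps_nth c 0) + h 1 (fps_nth a 0) (fps_nth b 0) (fps_nth c 0)"
  by (simp add: fps_ext3_def)

text \<open>Doubling \<open>v\<close> gives zero, and the scalar 2 is invertible. This turns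
  skew-symmetry on equal arguments into the alternating condition on cochains.\<close>

lemma self_neg_imp_zero:
  fixes scale :: "'k::field \<Rightarrow> 'l::ab_group_add \<Rightarrow> 'l" and v :: 'l
  assumes "module scale" and "CHAR('k) \<noteq> 2" and "v = - v"
  shows "v = 0"
proof -
  interpret module scale by fact
  have two: "(2::'k) \<noteq> 0"
  proof
    assume "(2::'k) = 0"
    then have "CHAR('k) dvd 2"
      using of_nat_eq_0_iff_char_dvd[of 2, where 'a = 'k] by simp
    \<comment> \<open>The value 1 is impossible because 0 and 1 differ in a field.\<close>
    then have "CHAR('k) = 1 \<or> CHAR('k) = 2"
      by (meson two_is_prime_nat prime_nat_iff)
    then show False
      using assms(2) by simp
  qed
  have "v + v = 0"
    by (metis assms(3) add.right_inverse)
  then have "scale 2 v = 0"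
    using scale_left_distrib[of 1 1 v] by simp
  then have "scale (inverse 2 * 2) v = 0"
    by (metis scale_scale scale_zero_right)
  with two show ?thesis
    by simp
qed

theorem proposition5p3:
  fixes scale :: "'k::alg_closed_field \<Rightarrow> 'l::ab_group_add \<Rightarrow> 'l"
    and br :: "'l \<Rightarrow> 'l \<Rightarrow> 'l"
    and tr :: "'l \<Rightarrow> 'l \<Rightarrow> 'l \<Rightarrow> 'l"
    and G :: "('g, 'm) monoid_scheme"
    and \<phi> :: "'g \<Rightarrow> 'l \<Rightarrow> 'l"
    and f :: "nat \<Rightarrow> 'l \<Rightarrow> 'l \<Rightarrow> 'l"
    and h :: "nat \<Rightarrow> 'l \<Rightarrow> 'l \<Rightarrow> 'l \<Rightarrow> 'l"
  assumes "CHAR('k) \<noteq> 2" and "CHAR('k) \<noteq> 3"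
    and "finite (carrier G)"
    and "lie_yamaguti_action scale br tr G \<phi>"
    and "equivariant_formal_deformation scale br tr G \<phi> f h"
  shows "(f 1, h 1) \<in> Z23_G scale br tr G \<phi>"
proof -
  interpret action: lie_yamaguti_action scale br tr G \<phi> by fact
  have f0: "f 0 = br" and h0: "h 0 = tr"
    and bil: "bilinear_op scale (f i)" and tri: "trilinear_op scale (h i)"
    and "lie_yamaguti (fps_scale scale) (fps_ext2 f) (fps_ext3 h)"
    and eqv: "equivariant2 G \<phi> (f 1)" "equivariant3 G \<phi> (h 1)" for i
    using assms(5) by (auto simp: equivariant_formal_deformation_def)
  then interpret def: lie_yamaguti "fps_scale scale" "fps_ext2 f" "fps_ext3 h"
    by simp
  \<comment> \<open>Constant series have coefficient 0 at t, so every term that uses such a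
    coefficient vanishes. The rules for \<open>br\<close> and \<open>tr\<close> are listed as well
    because \<open>f0\<close> and \<open>h0\<close> rewrite \<open>f 0\<close> and
    \<open>h 0\<close> to them.\<close>
  note zero = bilinear_op_zero[OF bil] trilinear_op_zero[OF tri]
    bilinear_op_zero[OF action.bilinear_br] trilinear_op_zero[OF action.trilinear_tr]
  note coeffs = fps_ext2_nth_0 fps_ext2_nth_1 fps_ext3_nth_0 fps_ext3_nth_1 f0 h0 zero
  have skew2: "f 1 x y = - f 1 y x" for x y
    using arg_cong[OF def.LY1[of "fps_const x" "fps_const y"], of "\<lambda>a. fps_nth a 1"]
    by (simp add: coeffs)
  have skew3: "h 1 x y z = - h 1 y x z" for x y z
    using arg_cong[OF def.LY2[of "fps_const x" "fps_const y" "fps_const z"], of "\<lambda>a. fps_nth a 1"]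
    by (simp add: coeffs)
  have alt: "f 1 x x = 0" "h 1 x x z = 0" for x z
    using self_neg_imp_zero[OF action.module_axioms assms(1)] skew2 skew3 by blast+
  \<comment> \<open>In each composite of LY5, the coefficient at t deforms either the inner or the
    outer operation. Skew-symmetry of \<open>br\<close> then moves \<open>h 1 x1 x2 x3\<close> into
    the second slot, which yields the minus sign in \<open>delta_I\<close>.\<close>
  have cocycle_I: "delta_I br tr (f 1) (h 1) x1 x2 x3 x4 = 0" for x1 x2 x3 x4
    using arg_cong[OF def.LY5[of "fps_const x1" "fps_const x2" "fps_const x3" "fps_const x4"],
        of "\<lambda>a. fps_nth a 1"]
      action.LY1[of "h 1 x1 x2 x3" x4]
    by (simp add: coeffs delta_I_def algebra_simps)
  \<comment> \<open>LY6 produces \<open>tr x3 (h 1 x1 x2 x4) x5\<close>; swapping its first two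
    arguments gives the negative term of \<open>delta_II\<close> with \<open>h x1 x2 x4\<close> in
    front.\<close>
  have cocycle_II: "delta_II tr (h 1) x1 x2 x3 x4 x5 = 0" for x1 x2 x3 x4 x5
    using arg_cong[OF def.LY6[of "fps_const x1" "fps_const x2" "fps_const x3" "fps_const x4"
          "fps_const x5"], of "\<lambda>a. fps_nth a 1"]
      action.LY2[of x3 "h 1 x1 x2 x4" x5]
    by (simp add: coeffs delta_II_def algebra_simps)
  show ?thesis
    using bil tri eqv alt cocycle_I cocycle_II
    by (simp add: Z23_G_def C2_G_def C3_G_def C2_def C3_def delta_def fun_eq_iff)
qed

end
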